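(* Let $X$ be a set and let $W_m : X^m \to X$ and $W_n : X^n \to X$ be an $m$-ary and an $n$-ary distributive operation on $X$ which are mutually distributive. Then the operation $W : X^{m+n-1} \to X$ defined by $$W(x, \mathbf{y}, \mathbf{z}) = W_n\bigl(W_m(x,\mathbf{y}), \mathbf{z}\bigr), \qquad x \in X,\ \mathbf{y}\in X^{m-1},\ \mathbf{z}\in X^{n-1},$$ is an $(m+n-1)$-ary distributive operation on $X$.
   Context: Notation: for an $n$-ary operation $W: X^n\to X$ and $\mathbf{y}=(y_1,\dots,y_{n-1})\in X^{n-1}$ write $W(x,\mathbf{y}) = W(x,y_1,\dots,y_{n-1})$; for $\mathbf{x}=(x_1,\dots,x_k)\in X^k$ write $W(\mathbf{x},\mathbf{y}) = (W(x_1,\mathbf{y}),\dots,W(x_k,\mathbf{y}))\in X^k$. Concatenation of vectors is written $(\mathbf{y},\mathbf{z})$, ignoring extra parentheses. An $n$-ary operation $W$ is (right self-)distributive if $W(W(x,\mathbf{y}),\mathbf{z}) = W(W(x,\mathbf{z}), W(\mathbf{y},\mathbf{z}))$ for all $x\in X$, $\mathbf{y},\mathbf{z}\in X^{n-1}$. Distributive operations $W_m$ ($m$-ary) and $W_n$ ($n$-ary) are mutually distributive if $$W_n(W_m(x,\mathbf{y}),\mathbf{z}) = W_m(W_n(x,\mathbf{z}), W_n(\mathbf{y},\mathbf{z})), \qquad W_m(W_n(x,\mathbf{u}),\mathbf{v}) = W_n(W_m(x,\mathbf{v}), W_m(\mathbf{u},\mathbf{v}))$$ for all $x\in X$, $\mathbf{y},\mathbf{v}\in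 X^{m-1}$, $\mathbf{z},\mathbf{u}\in X^{n-1}$. *)

theory Defs
  imports "HOL-Library.NList" "HOL-Library.FuncSet"
begin

text \<open>
  The carrier X is an arbitrary subset of a type. A tuple in \<open>X\<^sup>k\<close> is an element of
  \<open>nlists k X\<close>, and an n-ary operation is a function on lists; only its values on
  \<open>nlists n X\<close> are relevant. The notation \<open>W(x, y)\<close> with \<open>x \<in> X\<close> and \<open>y\<close> a tuple becomes
  \<open>W (x # y)\<close>, so the notions below make sense as intended for arities at least 1.
\<close>

definition nary_operation :: "nat \<Rightarrow> 'a set \<Rightarrow> ('a list \<Rightarrow> 'a) \<Rightarrow> bool" where
  "nary_operation n X W \<longleftrightarrow> W \<in> nlists n X \<rightarrow> X"

text \<open>The componentwise extension \<open>W(xs, y) = (W(x\<^sub>1, y), \<dots>, W(x\<^sub>k, y))\<close>.\<close>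

definition map_op :: "('a list \<Rightarrow> 'a) \<Rightarrow> 'a list \<Rightarrow> 'a list \<Rightarrow> 'a list" where
  "map_op W xs y = map (\<lambda>x. W (x # y)) xs"

definition distributive :: "nat \<Rightarrow> 'a set \<Rightarrow> ('a list \<Rightarrow> 'a) \<Rightarrow> bool" where
  "distributive n X W \<longleftrightarrow>
    (\<forall>x\<in>X. \<forall>y\<in>nlists (n - 1) X. \<forall>z\<in>nlists (n - 1) X.
      W (W (x # y) # z) = W (W (x # z) # map_op W y z))"

definition distributive_operation :: "nat \<Rightarrow> 'a set \<Rightarrow> ('a list \<Rightarrow> 'a) \<Rightarrow> bool" where
  "distributive_operation n X W \<longleftrightarrow> nary_operation n X W \<and> distributive n X W"

definition mutually_distributive ::
    "'a set \<Rightarrow> nat \<Rightarrow> ('a list \<Rightarrow> 'a) \<Rightarrow> nat \<Rightarrow> ('a list \<Rightarrow> 'a) \<Rightarrow> bool" where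
  "mutually_distributive X m Wm n Wn \<longleftrightarrow>
    (\<forall>x\<in>X. \<forall>y\<in>nlists (m - 1) X. \<forall>z\<in>nlists (n - 1) X.
      Wn (Wm (x # y) # z) = Wm (Wn (x # z) # map_op Wn y z)) \<and>
    (\<forall>x\<in>X. \<forall>u\<in>nlists (n - 1) X. \<forall>v\<in>nlists (m - 1) X.
      Wm (Wn (x # u) # v) = Wn (Wm (x # v) # map_op Wm u v))"

text \<open>
  The operation \<open>W(x, y, z) = Wn(Wm(x, y), z)\<close>: the first m entries \<open>(x, y)\<close> of the
  argument are fed into \<open>Wm\<close>. The defining equation is \<open>compose_op_eq\<close>.
\<close>

definition compose_op :: "nat \<Rightarrow> ('a list \<Rightarrow> 'a) \<Rightarrow> ('a list \<Rightarrow> 'a) \<Rightarrow> 'a list \<Rightarrow> 'a" where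
  "compose_op m Wm Wn xs = Wn (Wm (take m xs) # drop m xs)"

lemma compose_op_eq:
  assumes "1 \<le> m" and "y \<in> nlists (m - 1) X"
  shows "compose_op m Wm Wn (x # y @ z) = Wn (Wm (x # y) # z)"
proof -
  have "m = Suc (length y)"
    using assms by simp
  then show ?thesis
    by (simp add: compose_op_def)
qed

end

theory Submission
  imports Defs
begin

text \<open>For fixed \<open>z\<close>, call the map sending x to \<open>W (x # z)\<close> the
  translation by \<open>z\<close>. Distributivity of an operation says that its translations are
  endomorphisms of it; mutual distributivity says that the translations of \<open>Wm\<close> and of
  \<open>Wn\<close> are also endomorphisms of the other operation. The translation of the composite
  by \<open>c @ d\<close> is the \<open>Wm\<close>-translation by \<open>c\<close> followed by the
  \<open>Wn\<close>-translation by \<open>d\<close> (\<open>map_op_compose_op\<close> is the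
  componentwise form), so it respects both \<open>Wm\<close> and \<open>Wn\<close>, hence also the
  composite built from them. \<open>distributive_compose_op\<close> carries this out as a
  calculation; \<open>nary_operation_compose_op\<close> supplies closure.\<close>

lemma nary_operation_closed:
  assumes "nary_operation n X W" "1 \<le> n" "x \<in> X" "y \<in> nlists (n - 1) X"
  shows "W (x # y) \<in> X"
proof -
  obtain k where "n = Suc k"
    using assms(2) by (cases n) simp_all
  then have "x # y \<in> nlists n X"
    using assms(3,4) by simp
  with assms(1) show ?thesis
    unfolding nary_operation_def by (rule funcset_mem)
qed

lemma map_op_closed:
  assumes "nary_operation n X W" "1 \<le> n" "xs \<in> nlists k X" "y \<in> nlists (n - 1) X"
  shows "map_op W xs y \<in> nlists k X"
proof (rule nlistsI)
  show "length (map_op W xs y) = k"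
    using assms(3) by (simp add: map_op_def)
  show "set (map_op W xs y) \<subseteq> X"
    using nlistsE_set[OF assms(3)] nary_operation_closed[OF assms(1,2) _ assms(4)]
    by (auto simp: map_op_def)
qed

lemma map_op_append: "map_op W (xs @ ys) z = map_op W xs z @ map_op W ys z"
  by (simp add: map_op_def)

text \<open>This expresses a translation of the composite as two successive translations, with
  \<open>y\<close> of exactly the length that \<open>Wm\<close> consumes after the first
  entry.\<close>

lemma map_op_compose_op:
  assumes "1 \<le> m" "y \<in> nlists (m - 1) X"
  shows "map_op (compose_op m Wm Wn) xs (y @ z) = map_op Wn (map_op Wm xs y) z"
  using compose_op_eq[OF assms] by (simp add: map_op_def)

lemma nlists_add_split:
  assumes "xs \<in> nlists (i + j) X"
  obtains ys zs where "xs = ys @ zs" "ys \<in> nlists i X" "zs \<in> nlists j X"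
proof
  show "xs = take i xs @ drop i xs"
    by simp
  have "length xs = i + j" "set xs \<subseteq> X"
    by (rule nlistsE_length[OF assms], rule nlistsE_set[OF assms])
  then show "take i xs \<in> nlists i X" "drop i xs \<in> nlists j X"
    using set_take_subset[of i xs] set_drop_subset[of i xs] by (auto intro!: nlistsI)
qed

lemma nary_operation_compose_op:
  assumes "1 \<le> m" "1 \<le> n" "nary_operation m X Wm" "nary_operation n X Wn"
  shows "nary_operation (m + n - 1) X (compose_op m Wm Wn)"
  unfolding nary_operation_def
proof
  fix xs assume "xs \<in> nlists (m + n - 1) X"
  \<comment> \<open>Regrouping the arity puts the cut after the \<open>m\<close> entries that
    \<open>compose_op\<close> passes to \<open>Wm\<close>.\<close>
  then have "xs \<in> nlists (m + (n - 1)) X"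
    using assms(2) by simp
  then obtain u z where xs: "xs = u @ z" and u: "u \<in> nlists m X" and z: "z \<in> nlists (n - 1) X"
    by (rule nlists_add_split)
  have "Wm u \<in> X"
    using assms(3) u by (auto simp: nary_operation_def)
  then have "Wn (Wm u # z) \<in> X"
    using z by (rule nary_operation_closed[OF assms(4,2)])
  then show "compose_op m Wm Wn xs \<in> X"
    using nlistsE_length[OF u] by (simp add: compose_op_def xs)
qed

lemma distributive_operationD:
  assumes "distributive_operation n X W"
    and "x \<in> X" "y \<in> nlists (n - 1) X" "z \<in> nlists (n - 1) X"
  shows "W (W (x # y) # z) = W (W (x # z) # map_op W y z)"
  using assms unfolding distributive_operation_def distributive_def by blast

lemma mutually_distributiveD:
  assumes "mutually_distributive X m Wm n Wn" "x \<in> X"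
  shows "y \<in> nlists (m - 1) X \<Longrightarrow> z \<in> nlists (n - 1) X \<Longrightarrow>
      Wn (Wm (x # y) # z) = Wm (Wn (x # z) # map_op Wn y z)"
    and "u \<in> nlists (n - 1) X \<Longrightarrow> v \<in> nlists (m - 1) X \<Longrightarrow>
      Wm (Wn (x # u) # v) = Wn (Wm (x # v) # map_op Wm u v)"
  using assms unfolding mutually_distributive_def by blast+

text \<open>The translation by \<open>c\<close> is pushed through \<open>Wn\<close> and then
  \<open>Wm\<close>, after which the translation by \<open>d\<close> is pushed through in the same
  order. Each of these four moves is one of the four distributive laws assumed.\<close>

lemma distributive_compose_op:
  assumes m: "1 \<le> m" and n: "1 \<le> n"
    and Wm: "distributive_operation m X Wm"
    and Wn: "distributive_operation n X Wn"
    and mutual: "mutually_distributive X m Wm n Wn"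
  shows "distributive (m + n - 1) X (compose_op m Wm Wn)"
  unfolding distributive_def
proof (intro ballI)
  let ?W = "compose_op m Wm Wn"
  have op_m: "nary_operation m X Wm" and op_n: "nary_operation n X Wn"
    using Wm Wn by (simp_all add: distributive_operation_def)
  fix x y z
  assume x: "x \<in> X"
    and y: "y \<in> nlists (m + n - 1 - 1) X" and z: "z \<in> nlists (m + n - 1 - 1) X"
  \<comment> \<open>Subtraction on naturals truncates, so this relies on both arities being at least
    1.\<close>
  have arity: "m + n - 1 - 1 = (m - 1) + (n - 1)"
    using m n by simp
  obtain a b where y_eq: "y = a @ b" and a: "a \<in> nlists (m - 1) X" and b: "b \<in> nlists (n - 1) X"
    using y unfolding arity by (rule nlists_add_split)
  obtain c d where z_eq: "z = c @ d" and c: "c \<in> nlists (m - 1) X" and d: "d \<in> nlists (n - 1) X"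
    using z unfolding arity by (rule nlists_add_split)
  have closed_m: "Wm (t # c) \<in> X" "Wm (t # a) \<in> X" if "t \<in> X" for t
    by (rule nary_operation_closed[OF op_m m that c], rule nary_operation_closed[OF op_m m that a])
  \<comment> \<open>\<open>a'\<close> and \<open>b'\<close> are the two blocks of \<open>y\<close>
    after translation by \<open>c\<close>; \<open>q\<close> below is the translate of
    \<open>Wm (x # a)\<close>, already in its distributed form.\<close>
  define a' where "a' = map_op Wm a c"
  define b' where "b' = map_op Wm b c"
  have a': "a' \<in> nlists (m - 1) X" and b': "b' \<in> nlists (n - 1) X"
    unfolding a'_def b'_def by (rule map_op_closed[OF op_m m a c], rule map_op_closed[OF op_m m b c])
  define q where "q = Wm (Wm (x # c) # a')"
  have q: "q \<in> X"
    unfolding q_def by (rule nary_operation_closed[OF op_m m closed_m(1)[OF x] a'])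
  have "?W (?W (x # y) # z) = Wn (Wm (Wn (Wm (x # a) # b) # c) # d)"
    unfolding y_eq z_eq compose_op_eq[OF m a] compose_op_eq[OF m c] ..
  also have "Wm (Wn (Wm (x # a) # b) # c) = Wn (Wm (Wm (x # a) # c) # b')"
    unfolding b'_def by (rule mutually_distributiveD(2)[OF mutual closed_m(2)[OF x] b c])
  also have "Wm (Wm (x # a) # c) = q"
    unfolding a'_def q_def by (rule distributive_operationD[OF Wm x a c])
  also have "Wn (Wn (q # b') # d) = Wn (Wn (q # d) # map_op Wn b' d)"
    by (rule distributive_operationD[OF Wn q b' d])
  also have "Wn (q # d) = Wm (Wn (Wm (x # c) # d) # map_op Wn a' d)"
    unfolding q_def by (rule mutually_distributiveD(1)[OF mutual closed_m(1)[OF x] a' d])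
  \<comment> \<open>Translating \<open>y\<close> by \<open>z\<close> acts on its blocks separately,
    giving \<open>map_op Wn a' d\<close> and \<open>map_op Wn b' d\<close>. The first still has
    length \<open>m - 1\<close>, so the outer composite splits at this boundary.\<close>
  also have "Wn (Wm (Wn (Wm (x # c) # d) # map_op Wn a' d) # map_op Wn b' d)
      = ?W (?W (x # z) # map_op ?W y z)"
    unfolding y_eq z_eq map_op_append map_op_compose_op[OF m c] compose_op_eq[OF m c]
      a'_def[symmetric] b'_def[symmetric] compose_op_eq[OF m map_op_closed[OF op_n n a' d]] ..
  finally show "?W (?W (x # y) # z) = ?W (?W (x # z) # map_op ?W y z)" .
qed

theorem proposition3p6:
  fixes X :: "'a set" and m n :: nat and Wm Wn :: "'a list \<Rightarrow> 'a"
  assumes "1 \<le> m" and "1 \<le> n"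
    and "distributive_operation m X Wm"
    and "distributive_operation n X Wn"
    and "mutually_distributive X m Wm n Wn"
  shows "distributive_operation (m + n - 1) X (compose_op m Wm Wn)"
  using assms nary_operation_compose_op[of m n X Wm Wn] distributive_compose_op[OF assms]
  by (simp add: distributive_operation_def)

end
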